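(* Let $n,m\ge2$. For an integer $N=p_1^{\alpha_1}\cdots p_s^{\alpha_s}$ let $N^*=p_1^{\lceil\alpha_1/2\rceil}\cdots p_s^{\lceil\alpha_s/2\rceil}$. Then the clique number of $\Gamma(\mathbb{Z}_n\times\mathbb{Z}_m)$ is at least $$cl(\Gamma(\mathbb{Z}_n))+cl(\Gamma(\mathbb{Z}_m))+\Big(\frac{n}{n^*}-1\Big)\Big(\frac{m}{m^*}-1\Big),$$ where $cl$ denotes the clique number.
   Context: For a commutative ring $R$ with identity, the zero-divisor graph $\Gamma(R)$ is the simple undirected graph whose vertices are the nonzero zero-divisors of $R$, two distinct vertices $u,v$ being adjacent iff $uv=0$. The clique number is the maximum size of a set of pairwise adjacent vertices (taken to be $0$ for a graph without vertices). *)

theory Defs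
  imports
    "HOL-Number_Theory.Number_Theory"
    "HOL-Algebra.Chinese_Remainder"
    "Graph_Theory.Pair_Digraph"
begin

definition zero_divisors :: "('a, 'm) ring_scheme \<Rightarrow> 'a set" where
  "zero_divisors R =
    {a \<in> carrier R. \<exists>b \<in> carrier R. b \<noteq> \<zero>\<^bsub>R\<^esub> \<and> a \<otimes>\<^bsub>R\<^esub> b = \<zero>\<^bsub>R\<^esub>}"

text \<open>As usual in the session Graph_Theory, a simple undirected graph is a loop-free
  symmetric digraph without parallel arcs.\<close>

definition zero_divisor_graph :: "('a, 'm) ring_scheme \<Rightarrow> 'a pair_pre_digraph" where
  "zero_divisor_graph R =
    \<lparr> pverts = zero_divisors R - {\<zero>\<^bsub>R\<^esub>},
      parcs = {(u, v). u \<in> zero_divisors R - {\<zero>\<^bsub>R\<^esub>} \<and> v \<in> zero_divisors R - {\<zero>\<^bsub>R\<^esub>} \<and>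
                       u \<noteq> v \<and> u \<otimes>\<^bsub>R\<^esub> v = \<zero>\<^bsub>R\<^esub>} \<rparr>"

lemma pair_graph_zero_divisor_graph:
  assumes "cring R" "finite (carrier R)"
  shows "pair_graph (zero_divisor_graph R)"
proof -
  interpret cring R by fact
  have comm: "u \<otimes>\<^bsub>R\<^esub> v = v \<otimes>\<^bsub>R\<^esub> u" if "u \<in> zero_divisors R" "v \<in> zero_divisors R" for u v
    using that m_comm by (simp add: zero_divisors_def)
  have fin: "finite (zero_divisors R)"
    using assms(2) by (auto simp: zero_divisors_def)
  have "parcs (zero_divisor_graph R) \<subseteq> zero_divisors R \<times> zero_divisors R"
    by (auto simp: zero_divisor_graph_def)
  then have "finite (parcs (zero_divisor_graph R))"
    using fin by (meson finite_SigmaI finite_subset)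
  then show ?thesis
    using fin
    by unfold_locales
      (auto simp: zero_divisor_graph_def symmetric_def sym_def comm)
qed

text \<open>The empty clique is admitted, so a graph without vertices has clique number 0. The
  maximum is meaningful only if clique sizes are bounded, in particular for finite graphs.\<close>

definition clique_number :: "('a, 'b) pre_digraph \<Rightarrow> nat" where
  "clique_number G =
    Max {card C |C. finite C \<and> C \<subseteq> verts G \<and> pairwise (\<lambda>u v. u \<rightarrow>\<^bsub>G\<^esub> v) C}"

text \<open>The number written N-star in the source.\<close>

definition star :: "nat \<Rightarrow> nat" where
  "star N = (\<Prod>p \<in> prime_factors N. p ^ nat \<lceil>real (multiplicity p N) / 2\<rceil>)"

end

theory Submission
  imports Defs
begin

text \<open>The multiples of \<open>star n\<close> annihilate each other in \<open>\<int>\<^sub>n\<close>. A clique of \<open>\<Gamma>(\<int>\<^sub>n)\<close> can be exchanged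
  for an equally large set of nonzero elements with pairwise zero products which is moreover
  annihilated by all multiples of \<open>star n\<close>: an element that is not a multiple of \<open>star n\<close> has too
  small a valuation at some prime \<open>p\<close>, and is replaced by \<open>n / p\<^bsup>\<lceil>\<alpha>/2\<rceil>\<^esup>\<close>, where \<open>\<alpha>\<close> is the exponent
  of \<open>p\<close> in \<open>n\<close>. Taking such sets \<open>A\<close>, \<open>B\<close> for \<open>n\<close> and \<open>m\<close>, the sets \<open>A \<times> 0\<close>, \<open>0 \<times> B\<close> and the
  products of nonzero multiples of \<open>star n\<close> and of \<open>star m\<close> together form a clique.\<close>

section \<open>Halved exponents and divisibility by \<open>star n\<close>\<close>

definition half_mult :: "nat \<Rightarrow> nat \<Rightarrow> nat" where
  "half_mult n p = nat \<lceil>real (multiplicity p n) / 2\<rceil>"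

lemma half_mult_bounds:
  "multiplicity p n \<le> 2 * half_mult n p"
  "2 * half_mult n p \<le> multiplicity p n + 1"
  "half_mult n p \<le> multiplicity p n"
  unfolding half_mult_def by linarith+

lemma half_mult_pos:
  assumes "p \<in> prime_factors n"
  shows "0 < half_mult n p"
  using assms half_mult_bounds(1)[of p n] by (simp add: prime_factors_multiplicity)

lemma star_eq: "star n = (\<Prod>p \<in> prime_factors n. p ^ half_mult n p)"
  by (simp add: star_def half_mult_def)

lemma star_pos: "0 < star n"
  unfolding star_eq by (intro prod_pos) (auto simp: in_prime_factors_iff prime_gt_0_nat)

lemma prime_power_half_dvd_star:
  assumes "p \<in> prime_factors n"
  shows "p ^ half_mult n p dvd star n"
  unfolding star_eq using assms by (intro dvd_prodI) auto

lemma star_dvd: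
  assumes "0 < n"
  shows "star n dvd n"
proof -
  have "star n dvd (\<Prod>p \<in> prime_factors n. p ^ multiplicity p n)"
    unfolding star_eq by (intro prod_dvd_prod le_imp_power_dvd half_mult_bounds)
  then show ?thesis
    using assms by (simp add: prod_prime_factors)
qed

text \<open>Squaring doubles each exponent, and twice the rounded-up half of an exponent is at least
  that exponent.\<close>

lemma dvd_star_square:
  assumes "0 < n"
  shows "n dvd star n * star n"
proof -
  have "(\<Prod>p \<in> prime_factors n. p ^ multiplicity p n) dvd
      (\<Prod>p \<in> prime_factors n. p ^ half_mult n p * p ^ half_mult n p)"
    using half_mult_bounds(1)[of _ n]
    by (intro prod_dvd_prod) (simp flip: power_add mult_2 add: le_imp_power_dvd)
  then show ?thesis
    using assms by (simp add: prod_prime_factors star_eq prod.distrib)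
qed

lemma dvd_mult_star_multiples:
  assumes "0 < n" "star n dvd c" "star n dvd d"
  shows "n dvd c * d"
  using dvd_star_square[OF assms(1)] mult_dvd_mono[OF assms(2,3)] by (rule dvd_trans)

text \<open>Multiplicities are compared prime by prime. The contrapositive serves the exchange: a
  non-multiple of \<open>star n\<close> falls short at some prime factor of
  \<open>n\<close>.\<close>

lemma star_dvdI:
  assumes "\<And>p. p \<in> prime_factors n \<Longrightarrow> p ^ half_mult n p dvd s"
  shows "star n dvd s"
proof (cases "s = 0")
  case False
  show ?thesis
  proof (rule multiplicity_le_imp_dvd)
    show "star n \<noteq> 0" using star_pos[of n] by simp
  next
    fix p :: nat assume "prime p"
    then have "multiplicity p (star n) = (if p \<in> prime_factors n then half_mult n p else 0)"
      unfolding star_eq by (intro multiplicity_prod_prime_powers) auto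
    then show "multiplicity p (star n) \<le> multiplicity p s"
      using assms[of p] \<open>prime p\<close> False
      by (auto intro!: multiplicity_geI simp: prime_gt_Suc_0_nat)
  qed
qed simp

text \<open>The factor \<open>s\<close> carries at most \<open>e - 1\<close> of the at least
  \<open>a\<close> factors \<open>p\<close>, so \<open>t\<close> carries the rest. The bound on
  \<open>e\<close> keeps the truncated subtraction exact.\<close>

lemma prime_power_dvd_cofactor:
  fixes p s t :: nat
  assumes "prime p" "p ^ a dvd s * t" "\<not> p ^ e dvd s" "e \<le> a"
  shows "p ^ (a - e + 1) dvd t"
proof (cases "t = 0")
  case False
  have "s \<noteq> 0" using assms(3) by (cases "s = 0") auto
  have pe: "prime_elem p" "\<not> is_unit p" using assms(1) by auto
  have "a \<le> multiplicity p (s * t)"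
    using assms(2) \<open>s \<noteq> 0\<close> False pe by (intro multiplicity_geI) auto
  then have "a \<le> multiplicity p s + multiplicity p t"
    using prime_elem_multiplicity_mult_distrib[OF pe(1) \<open>s \<noteq> 0\<close> False] by simp
  moreover have "multiplicity p s < e"
    using assms(3) \<open>s \<noteq> 0\<close> pe by (meson multiplicity_dvd' not_le)
  ultimately show ?thesis
    using assms(4) by (intro multiplicity_dvd') linarith
qed simp

section \<open>The replacement elements\<close>

text \<open>For \<open>n > 0\<close> and a prime \<open>p\<close>, this element annihilates exactly
  the multiples of \<open>p ^ half_mult n p\<close> modulo \<open>n\<close>. Away from
  \<open>p\<close> it has the same exponents as \<open>n\<close>.\<close>

definition large_cofactor :: "nat \<Rightarrow> nat \<Rightarrow> nat" where
  "large_cofactor n p = n div p ^ half_mult n p"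

lemma large_cofactor_mult: "large_cofactor n p * p ^ half_mult n p = n"
proof -
  have "p ^ half_mult n p dvd n"
    by (intro multiplicity_dvd' half_mult_bounds)
  then show ?thesis by (simp add: large_cofactor_def)
qed

context
  fixes n p :: nat
  assumes n: "0 < n" and p: "p \<in> prime_factors n"
begin

lemma large_cofactor_in_range: "large_cofactor n p \<in> {0<..<n}"
proof -
  have "1 < p ^ half_mult n p"
    using p half_mult_pos[OF p] by (intro one_less_power) (simp_all add: in_prime_factors_iff prime_gt_Suc_0_nat)
  moreover have "0 < large_cofactor n p"
    using large_cofactor_mult[of n p] n by (cases "large_cofactor n p") auto
  ultimately have "large_cofactor n p * 1 < large_cofactor n p * p ^ half_mult n p"
    by (intro mult_strict_left_mono)
  then show ?thesis
    using \<open>0 < large_cofactor n p\<close> by (simp add: large_cofactor_mult)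
qed

lemma dvd_large_cofactor_mult_star:
  assumes "star n dvd d"
  shows "n dvd large_cofactor n p * d"
proof -
  have "p ^ half_mult n p dvd d"
    using prime_power_half_dvd_star[OF p] assms by (rule dvd_trans)
  then show ?thesis
    by (metis large_cofactor_mult dvd_refl mult_dvd_mono)
qed

text \<open>Dividing \<open>n\<close> by a power of \<open>q\<close> leaves its
  \<open>p\<close>-part intact, so the second factor restores the power of \<open>p\<close> that the
  first one lacks.\<close>

lemma dvd_large_cofactor_mult:
  assumes "q \<in> prime_factors n" "p \<noteq> q"
  shows "n dvd large_cofactor n p * large_cofactor n q"
proof -
  have "coprime (p ^ half_mult n p) (q ^ half_mult n q)"
    using assms p primes_coprime[of p q] by (auto simp: in_prime_factors_iff)
  moreover have "p ^ half_mult n p dvd large_cofactor n q * q ^ half_mult n q"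
    unfolding large_cofactor_mult by (intro multiplicity_dvd' half_mult_bounds)
  ultimately have "p ^ half_mult n p dvd large_cofactor n q"
    by (simp add: coprime_dvd_mult_left_iff)
  then show ?thesis
    by (metis large_cofactor_mult dvd_refl mult_dvd_mono)
qed

text \<open>One more factor \<open>p\<close> in the cofactor would give \<open>n\<close> one factor
  \<open>p\<close> too many. This bound tells replacements apart from retained elements and from
  each other.\<close>

lemma not_dvd_large_cofactor:
  "\<not> p ^ (multiplicity p n - half_mult n p + 1) dvd large_cofactor n p"
proof
  assume "p ^ (multiplicity p n - half_mult n p + 1) dvd large_cofactor n p"
  then have "p ^ (multiplicity p n - half_mult n p + 1) * p ^ half_mult n p dvd n"
    by (metis large_cofactor_mult dvd_refl mult_dvd_mono)
  moreover have "multiplicity p n - half_mult n p + 1 + half_mult n p = multiplicity p n + 1"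
    using half_mult_bounds(3)[of n p] by simp
  ultimately have "p ^ (multiplicity p n + 1) dvd n"
    by (metis power_add)
  moreover have "\<not> is_unit p"
    using p by (auto dest: in_prime_factors_imp_prime)
  ultimately show False
    using n power_dvd_iff_le_multiplicity[of n p "multiplicity p n + 1"] by simp
qed

end

section \<open>Exchange of clique elements\<close>

text \<open>The size is preserved because distinct elements fall short at distinct primes, and
  exponents at these primes separate the replacements from each other and from the retained
  elements.\<close>

lemma exchange_clique:
  assumes n: "0 < n" and C: "C \<subseteq> {0<..<n}" and zero: "pairwise (\<lambda>s t. n dvd s * t) C"
  obtains A where "A \<subseteq> {0<..<n}" "card A = card C" "pairwise (\<lambda>s t. n dvd s * t) A"
    "\<And>c d. c \<in> A \<Longrightarrow> star n dvd d \<Longrightarrow> n dvd c * d"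
proof -
  define S where "S = {s \<in> C. \<not> star n dvd s}"
  have "finite C" using C by (rule finite_subset) simp
  have "\<exists>p. p \<in> prime_factors n \<and> \<not> p ^ half_mult n p dvd s" if "s \<in> S" for s
    using that star_dvdI[of n s] by (auto simp: S_def)
  then obtain f where f: "\<And>s. s \<in> S \<Longrightarrow> f s \<in> prime_factors n"
      and nd: "\<And>s. s \<in> S \<Longrightarrow> \<not> f s ^ half_mult n (f s) dvd s"
    by metis
  \<comment> \<open>If \<open>s\<close> is short at its prime, every other element of the clique
    must compensate there for the product to be divisible by \<open>n\<close>.\<close>
  have big: "f s ^ (multiplicity (f s) n - half_mult n (f s) + 1) dvd t"
    if "s \<in> S" "t \<in> C" "s \<noteq> t" for s t
  proof (rule prime_power_dvd_cofactor[OF _ _ nd[OF \<open>s \<in> S\<close>] half_mult_bounds(3)])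
    show "prime (f s)" using f[OF \<open>s \<in> S\<close>] by auto
    have "n dvd s * t" using zero that by (auto simp: pairwise_def S_def)
    then show "f s ^ multiplicity (f s) n dvd s * t"
      using multiplicity_dvd by (rule dvd_trans[rotated])
  qed
  have f_neq: "f s \<noteq> f t" if "s \<in> S" "t \<in> S" "s \<noteq> t" for s t
  proof
    assume "f s = f t"
    \<comment> \<open>With h the halved exponent and \<alpha> the full one, 2h \<le> \<alpha> + 1
      gives h \<le> \<alpha> - h + 1. So the compensating \<open>t\<close> cannot be short at the
      prime of \<open>s\<close>.\<close>
    have "f s ^ half_mult n (f s) dvd f s ^ (multiplicity (f s) n - half_mult n (f s) + 1)"
      using half_mult_bounds[of "f s" n] half_mult_bounds[of n "f s"]
      by (intro le_imp_power_dvd) linarith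
    also have "\<dots> dvd t" using big that by (simp add: S_def)
    finally show False using nd[OF \<open>t \<in> S\<close>] \<open>f s = f t\<close> by simp
  qed
  define g where "g s = large_cofactor n (f s)" for s
  \<comment> \<open>At the prime of \<open>s\<close>, the retained \<open>t\<close> has by
    \<open>big\<close> a larger exponent than the replacement \<open>g s\<close>.\<close>
  have g_new: "g s \<noteq> t" if "s \<in> S" "t \<in> C - S" for s t
  proof -
    have "s \<noteq> t" using that by auto
    then show ?thesis
      using big[of s t] not_dvd_large_cofactor[OF n f[OF that(1)]] that by (auto simp: g_def)
  qed
  have gg: "n dvd g s * g t" if "s \<in> S" "t \<in> S" "s \<noteq> t" for s t
    unfolding g_def using that f f_neq n by (intro dvd_large_cofactor_mult) auto
  have g_star: "n dvd g s * d" if "s \<in> S" "star n dvd d" for s d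
    unfolding g_def using that f n by (intro dvd_large_cofactor_mult_star) auto
  have inj: "inj_on g S"
  proof (rule inj_onI, rule ccontr)
    fix s t assume st: "s \<in> S" "t \<in> S" "g s = g t" "s \<noteq> t"
    let ?p = "f s" and ?q = "f t"
    have pq: "coprime ?p ?q"
      using f_neq st f primes_coprime by (metis in_prime_factors_imp_prime)
    \<comment> \<open>Only the power of \<open>?q\<close> is removed in \<open>g t\<close>, so it
      keeps the full power of \<open>?p\<close>; \<open>g s\<close> has lost a positive power of
      \<open>?p\<close>.\<close>
    have "?p ^ multiplicity ?p n dvd g t * ?q ^ half_mult n ?q"
      unfolding g_def large_cofactor_mult by (rule multiplicity_dvd)
    then have "?p ^ multiplicity ?p n dvd g t"
      using pq by (simp add: coprime_dvd_mult_left_iff)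
    moreover have "?p ^ (multiplicity ?p n - half_mult n ?p + 1) dvd ?p ^ multiplicity ?p n"
      using half_mult_pos[OF f[OF st(1)]] half_mult_bounds(3)[of n ?p]
      by (intro le_imp_power_dvd) linarith
    ultimately show False
      using not_dvd_large_cofactor[OF n f[OF st(1)]] st(3) by (metis dvd_trans g_def)
  qed
  define A where "A = (C - S) \<union> g ` S"
  have "S \<subseteq> C" by (auto simp: S_def)
  then have "finite S" using \<open>finite C\<close> by (rule finite_subset)
  show thesis
  proof
    show "A \<subseteq> {0<..<n}"
      using C large_cofactor_in_range[OF n f] by (auto simp: A_def g_def)
    have "card A = card (C - S) + card S"
      unfolding A_def card_image[OF inj, symmetric] using \<open>finite C\<close> \<open>finite S\<close> g_new
      by (intro card_Un_disjoint) auto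
    then show "card A = card C"
      using \<open>S \<subseteq> C\<close> \<open>finite S\<close> \<open>finite C\<close> card_mono[of C S] by (simp add: card_Diff_subset)
    show ann: "n dvd c * d" if "c \<in> A" "star n dvd d" for c d
      using that g_star dvd_mult_star_multiples[OF n] by (auto simp: A_def S_def)
    have star_A: "star n dvd c" if "c \<in> C - S" for c
      using that by (auto simp: S_def)
    show "pairwise (\<lambda>s t. n dvd s * t) A"
    proof (rule pairwiseI)
      fix c d assume cd: "c \<in> A" "d \<in> A" "c \<noteq> d"
      \<comment> \<open>Retained elements are multiples of \<open>star n\<close>, so
        \<open>ann\<close> settles every pair except two replacements.\<close>
      consider "star n dvd d" | "star n dvd c" | "c \<in> g ` S" "d \<in> g ` S"
        using cd star_A by (auto simp: A_def)
      then show "n dvd c * d"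
      proof cases
        case 1
        then show ?thesis using ann cd by blast
      next
        case 2
        then show ?thesis using ann[of d c] cd by (simp add: mult.commute)
      next
        case 3
        then show ?thesis using gg cd(3) by blast
      qed
    qed
  qed
qed

section \<open>Clique numbers and passage between rings and divisibility\<close>

lemma finite_clique_cards:
  assumes "finite (verts G)"
  shows "finite {card C |C. finite C \<and> C \<subseteq> verts G \<and> pairwise (\<lambda>u v. u \<rightarrow>\<^bsub>G\<^esub> v) C}"
proof (rule finite_subset)
  show "{card C |C. finite C \<and> C \<subseteq> verts G \<and> pairwise (\<lambda>u v. u \<rightarrow>\<^bsub>G\<^esub> v) C}
      \<subseteq> {..card (verts G)}"
    using assms by (auto intro: card_mono)
qed simp

lemma card_le_clique_number:
  assumes "finite (verts G)" "C \<subseteq> verts G" "pairwise (\<lambda>u v. u \<rightarrow>\<^bsub>G\<^esub> v) C"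
  shows "card C \<le> clique_number G"
  unfolding clique_number_def
  using assms finite_subset by (intro Max_ge finite_clique_cards) auto

lemma clique_number_attained:
  assumes "finite (verts G)"
  obtains C where "C \<subseteq> verts G" "pairwise (\<lambda>u v. u \<rightarrow>\<^bsub>G\<^esub> v) C" "card C = clique_number G"
proof -
  let ?S = "{card C |C. finite C \<and> C \<subseteq> verts G \<and> pairwise (\<lambda>u v. u \<rightarrow>\<^bsub>G\<^esub> v) C}"
  \<comment> \<open>The empty clique makes the maximum range over a nonempty set, even for a graph
    without vertices.\<close>
  have "card {} \<in> ?S" by (intro CollectI exI[of _ "{}"]) simp
  then have "clique_number G \<in> ?S"
    unfolding clique_number_def by (intro Max_in finite_clique_cards assms) blast
  then show thesis using that by auto
qed

lemma finite_zero_divisor_graph: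
  assumes "finite (carrier R)"
  shows "finite (verts (with_proj (zero_divisor_graph R)))"
  using assms by (auto simp: zero_divisor_graph_def zero_divisors_def)

text \<open>Taking natural representatives of a maximum clique turns vanishing products into
  divisibility by \<open>n\<close>, the form that the exchange works with.\<close>

lemma residue_clique_number_attained:
  assumes n: "0 < n"
  obtains C where "C \<subseteq> {0<..<n}" "pairwise (\<lambda>s t. n dvd s * t) C"
    "card C = clique_number (with_proj (zero_divisor_graph (residue_ring (int n))))"
proof -
  let ?G = "with_proj (zero_divisor_graph (residue_ring (int n)))"
  have "finite (verts ?G)"
    by (rule finite_zero_divisor_graph) (simp add: residue_ring_def)
  then obtain K where K: "K \<subseteq> verts ?G" "pairwise (\<lambda>u v. u \<rightarrow>\<^bsub>?G\<^esub> v) K"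
      "card K = clique_number ?G"
    by (rule clique_number_attained)
  have range: "0 < u" "u < int n" if "u \<in> K" for u
    using that K(1) by (force simp: zero_divisor_graph_def zero_divisors_def residue_ring_def)+
  show thesis
  proof
    show "nat ` K \<subseteq> {0<..<n}" using range by force
    show "pairwise (\<lambda>s t. n dvd s * t) (nat ` K)"
    proof (rule pairwiseI)
      fix s t assume "s \<in> nat ` K" "t \<in> nat ` K" "s \<noteq> t"
      then obtain u v where uv: "u \<in> K" "v \<in> K" "s = nat u" "t = nat v" "u \<noteq> v" by auto
      have "u * v mod int n = 0"
        using K(2) uv
        by (auto simp: pairwise_def zero_divisor_graph_def residue_ring_def)
      then have "int n dvd int (s * t)"
        using uv range by (simp add: dvd_eq_mod_eq_0 less_imp_le)
      then show "n dvd s * t" by (simp only: of_nat_dvd_iff)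
    qed
    have "inj_on nat K" using range by (auto intro!: inj_onI simp: less_imp_le eq_nat_nat_iff)
    then show "card (nat ` K) = clique_number ?G" using K(3) by (simp add: card_image)
  qed
qed

text \<open>Embedding the pairs into the integers gives a clique of the same size. The pairwise
  condition yields no annihilator for a singleton, so \<open>zd\<close> provides one for each
  element, possibly the element itself.\<close>

lemma card_le_clique_number_prod:
  fixes n m :: nat
  assumes K: "K \<subseteq> {..<n} \<times> {..<m} - {(0, 0)}"
    and zd: "\<And>a b. (a, b) \<in> K \<Longrightarrow>
      \<exists>c d. (c, d) \<in> {..<n} \<times> {..<m} - {(0, 0)} \<and> n dvd a * c \<and> m dvd b * d"
    and zero: "pairwise (\<lambda>(a, b) (c, d). n dvd a * c \<and> m dvd b * d) K"
  shows "card K \<le> clique_number (with_proj (zero_divisor_graph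
           (RDirProd (residue_ring (int n)) (residue_ring (int m)))))"
proof -
  let ?R = "RDirProd (residue_ring (int n)) (residue_ring (int m))"
  let ?G = "with_proj (zero_divisor_graph ?R)"
  have carrier: "carrier ?R = {0..int n - 1} \<times> {0..int m - 1}"
    by (simp add: RDirProd_carrier residue_ring_def)
  have mult: "(a, b) \<otimes>\<^bsub>?R\<^esub> (c, d) = (a * c mod int n, b * d mod int m)" for a b c d
    by (simp add: RDirProd_def DirProd_def monoid.defs residue_ring_def)
  have zero_R: "\<zero>\<^bsub>?R\<^esub> = (0, 0)"
    by (simp add: RDirProd_def DirProd_def monoid.defs residue_ring_def)
  let ?h = "map_prod int int"
  have mult_zero: "?h (a, b) \<otimes>\<^bsub>?R\<^esub> ?h (c, d) = \<zero>\<^bsub>?R\<^esub> \<longleftrightarrow> n dvd a * c \<and> m dvd b * d"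
    for a b c d
    by (simp add: mult zero_R flip: of_nat_mult zmod_int dvd_eq_mod_eq_0)
  have V: "?h x \<in> verts ?G" if x: "x \<in> K" for x
  proof -
    obtain a b where ab: "x = (a, b)" by force
    obtain c d where cd: "(c, d) \<in> {..<n} \<times> {..<m} - {(0, 0)}" "n dvd a * c" "m dvd b * d"
      using zd x ab by blast
    have "?h (c, d) \<in> carrier ?R" "?h (c, d) \<noteq> \<zero>\<^bsub>?R\<^esub>" "?h x \<otimes>\<^bsub>?R\<^esub> ?h (c, d) = \<zero>\<^bsub>?R\<^esub>"
      using cd mult_zero[of a b c d] by (auto simp: ab carrier zero_R)
    moreover have "?h x \<in> carrier ?R" "?h x \<noteq> \<zero>\<^bsub>?R\<^esub>"
      using x K by (auto simp: ab carrier zero_R)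
    ultimately show ?thesis
      by (auto simp: zero_divisor_graph_def zero_divisors_def)
  qed
  have "inj ?h" by (intro prod.inj_map inj_of_nat)
  then have "card K = card (?h ` K)" by (metis card_image inj_on_subset subset_UNIV)
  also have "\<dots> \<le> clique_number ?G"
  proof (rule card_le_clique_number)
    show "finite (verts ?G)" by (rule finite_zero_divisor_graph) (simp add: carrier)
    show "?h ` K \<subseteq> verts ?G" using V by (rule image_subsetI)
    show "pairwise (\<lambda>u v. u \<rightarrow>\<^bsub>?G\<^esub> v) (?h ` K)"
    proof (rule pairwiseI)
      fix u v assume uv: "u \<in> ?h ` K" "v \<in> ?h ` K" "u \<noteq> v"
      then obtain a b c d where abcd: "(a, b) \<in> K" "(c, d) \<in> K" "u = ?h (a, b)" "v = ?h (c, d)"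
        by force
      then have "n dvd a * c \<and> m dvd b * d"
        using zero uv(3) by (auto simp: pairwise_def)
      then have "u \<otimes>\<^bsub>?R\<^esub> v = \<zero>\<^bsub>?R\<^esub>" using mult_zero abcd by blast
      then show "u \<rightarrow>\<^bsub>?G\<^esub> v"
        using uv V by (auto simp: zero_divisor_graph_def)
    qed
  qed
  finally show ?thesis .
qed

section \<open>The clique in the product ring\<close>

text \<open>As \<open>star n\<close> divides \<open>n\<close>, its multiples strictly between
  \<open>0\<close> and \<open>n\<close> are \<open>star n * i\<close> with
  \<open>0 < i < n div star n\<close>. There are none when \<open>star n = n\<close>.\<close>

lemma star_multiples:
  assumes "0 < n"
  obtains D where "D \<subseteq> {0<..<n}" "\<And>d. d \<in> D \<Longrightarrow> star n dvd d"
    "real (card D) = real n / real (star n) - 1"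
proof
  let ?D = "(\<lambda>i. star n * i) ` {0<..<n div star n}"
  have eq: "star n * (n div star n) = n" using star_dvd[OF assms] by simp
  have "star n * i < n" if "i < n div star n" for i
    using that star_pos[of n] eq by (metis nat_mult_less_cancel1)
  then show "?D \<subseteq> {0<..<n}" using star_pos[of n] by auto
  show "\<And>d. d \<in> ?D \<Longrightarrow> star n dvd d" by auto
  have "0 < n div star n" using eq assms by (cases "n div star n") auto
  moreover have "card ?D = n div star n - 1"
    using star_pos[of n] by (subst card_image) (auto intro!: inj_onI)
  ultimately show "real (card ?D) = real n / real (star n) - 1"
    by (simp add: real_of_nat_div[OF star_dvd[OF assms]] of_nat_diff)
qed

theorem theorem3p8:
  fixes n m :: nat
  assumes "n \<ge> 2" and "m \<ge> 2"
  shows "real (clique_number (with_proj (zero_divisor_graph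
             (RDirProd (residue_ring (int n)) (residue_ring (int m))))))
         \<ge> real (clique_number (with_proj (zero_divisor_graph (residue_ring (int n)))))
           + real (clique_number (with_proj (zero_divisor_graph (residue_ring (int m)))))
           + (real n / real (star n) - 1) * (real m / real (star m) - 1)"
proof -
  have n: "0 < n" and m: "0 < m" using assms by auto
  obtain A where A: "A \<subseteq> {0<..<n}" "pairwise (\<lambda>s t. n dvd s * t) A"
      "\<And>c d. c \<in> A \<Longrightarrow> star n dvd d \<Longrightarrow> n dvd c * d"
      "card A = clique_number (with_proj (zero_divisor_graph (residue_ring (int n))))"
    using residue_clique_number_attained[OF n] exchange_clique[OF n] by metis
  obtain B where B: "B \<subseteq> {0<..<m}" "pairwise (\<lambda>s t. m dvd s * t) B"
      "\<And>c d. c \<in> B \<Longrightarrow> star m dvd d \<Longrightarrow> m dvd c * d"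
      "card B = clique_number (with_proj (zero_divisor_graph (residue_ring (int m))))"
    using residue_clique_number_attained[OF m] exchange_clique[OF m] by metis
  obtain D where D: "D \<subseteq> {0<..<n}" "\<And>d. d \<in> D \<Longrightarrow> star n dvd d"
      "real (card D) = real n / real (star n) - 1"
    using star_multiples[OF n] by blast
  obtain E where E: "E \<subseteq> {0<..<m}" "\<And>d. d \<in> E \<Longrightarrow> star m dvd d"
      "real (card E) = real m / real (star m) - 1"
    using star_multiples[OF m] by blast
  have A': "n dvd d * c" if "c \<in> A" "d \<in> D" for c d
    using A(3)[OF that(1) D(2)[OF that(2)]] by (simp add: mult.commute)
  have B': "m dvd d * c" if "c \<in> B" "d \<in> E" for c d
    using B(3)[OF that(1) E(2)[OF that(2)]] by (simp add: mult.commute)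
  have DD: "n dvd c * d" if "c \<in> D" "d \<in> D" for c d
    using that D(2) n by (intro dvd_mult_star_multiples)
  have EE: "m dvd c * d" if "c \<in> E" "d \<in> E" for c d
    using that E(2) m by (intro dvd_mult_star_multiples)
  let ?K = "A \<times> {0} \<union> {0} \<times> B \<union> D \<times> E"
  have fin: "finite A" "finite B" "finite D" "finite E"
    using A(1) B(1) D(1) E(1) by (auto intro: finite_subset)
  \<comment> \<open>The three pieces are disjoint because none of \<open>A\<close>,
    \<open>B\<close>, \<open>D\<close>, \<open>E\<close> contains \<open>0\<close>.\<close>
  have "card ?K = card (A \<times> {0::nat} \<union> {0::nat} \<times> B) + card (D \<times> E)"
    using fin D(1) E(1) by (intro card_Un_disjoint) auto
  also have "card (A \<times> {0::nat} \<union> {0::nat} \<times> B) = card (A \<times> {0::nat}) + card ({0::nat} \<times> B)"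
    using fin A(1) by (intro card_Un_disjoint) auto
  finally have "card ?K = card A + card B + card D * card E"
    by (simp add: card_cartesian_product)
  moreover have "card ?K \<le> clique_number (with_proj (zero_divisor_graph
           (RDirProd (residue_ring (int n)) (residue_ring (int m)))))"
  proof (rule card_le_clique_number_prod)
    show "?K \<subseteq> {..<n} \<times> {..<m} - {(0, 0)}"
      using A(1) B(1) D(1) E(1) n m by auto
    show "\<exists>c d. (c, d) \<in> {..<n} \<times> {..<m} - {(0, 0)} \<and> n dvd a * c \<and> m dvd b * d"
      if ab: "(a, b) \<in> ?K" for a b
    proof -
      \<comment> \<open>The annihilators are \<open>(0, 1)\<close>, \<open>(1, 0)\<close> and the
        pair itself, whose square vanishes. The first two are nonzero residue pairs because both
        moduli are at least 2.\<close>
      consider "b = 0" | "a = 0" | "a \<in> D" "b \<in> E" using ab by auto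
      then show ?thesis
      proof cases
        case 1
        then show ?thesis using assms by (intro exI[of _ 0] exI[of _ 1]) auto
      next
        case 2
        then show ?thesis using assms by (intro exI[of _ 1] exI[of _ 0]) auto
      next
        case 3
        then show ?thesis using D(1) E(1) DD EE by (intro exI[of _ a] exI[of _ b]) auto
      qed
    qed
    \<comment> \<open>\<open>DD\<close> and \<open>EE\<close> also cover equal arguments, which
      arise when distinct pairs in \<open>D \<times> E\<close> share a coordinate.\<close>
    show "pairwise (\<lambda>(a, b) (c, d). n dvd a * c \<and> m dvd b * d) ?K"
      using A(2) B(2) A(3)[OF _ D(2)] B(3)[OF _ E(2)] A' B' DD EE by (auto simp: pairwise_def)
  qed
  ultimately have "real (card A + card B + card D * card E) \<le> real (clique_number (with_proj
      (zero_divisor_graph (RDirProd (residue_ring (int n)) (residue_ring (int m))))))"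
    by (simp only: of_nat_le_iff)
  then show ?thesis
    by (simp add: A(4) B(4) D(3) E(3))
qed

end
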